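(* Let $\alpha>0$, $N=0$, $\beta=1$, $\gamma=14$. For a positive integer $K$, consider the instance consisting of a link $\ell_1$ and pairwise disjoint sets of links $S_1,\dots,S_K$ with $|S_k|=2^{2(k-1)}$, so $n=1+\sum_{k=1}^K|S_k|$ links in total, where every link has length $1$, for every $i\in S_k$ the sender-to-receiver distances satisfy $d_{i1}=d_{1i}=(\gamma|S_k|)^{1/\alpha}$, and for any two distinct links $i,j\neq \ell_1$, $d_{ij}=d_{ji}=d_{i1}+d_{j1}$. Then (i) there exists a power assignment $P$ under which the whole set $L$ of these $n$ links is SINR-feasible; and (ii) $L$ cannot be partitioned into $o(\log n)$ sets each of which is SINR-feasible under uniform power $\mathcal{U}$; i.e., there is a constant $c>0$ (depending on $\alpha$) such that for all sufficiently large $K$ every such partition has at least $c\log n$ parts.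
   Context: For links $\ell_i,\ell_j$, $d_{ij}$ denotes the distance from the sender of $\ell_i$ to the receiver of $\ell_j$. Given a power assignment $P$ ($P_i>0$), path-loss exponent $\alpha$, noise $N=0$ and threshold $\beta=1$, the affectance of $\ell_j$ on $\ell_i$ ($j\ne i$) is $a^P_j(i)=\frac{P_j}{P_i}(\ell_i/d_{ji})^\alpha$, and a set $S$ is SINR-feasible under $P$ if $\sum_{j\in S, j\ne i}a^P_j(i)\le1$ for every $i\in S$. Uniform power $\mathcal{U}$ assigns the same power to every link. *)

theory Defs
  imports "HOL-Analysis.Analysis" "HOL-Library.Disjoint_Sets"
begin

text \<open>
  Links are the elements of a type \<open>'l\<close>; link \<open>i\<close> has its sender at the point \<open>s i\<close> and its
  receiver at the point \<open>r i\<close> of a space with distance function \<open>\<delta>\<close>.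
\<close>

definition link_dist ::
  "('p \<Rightarrow> 'p \<Rightarrow> real) \<Rightarrow> ('l \<Rightarrow> 'p) \<Rightarrow> ('l \<Rightarrow> 'p) \<Rightarrow> 'l \<Rightarrow> 'l \<Rightarrow> real" where
  "link_dist \<delta> s r i j = \<delta> (s i) (r j)"

definition link_length ::
  "('p \<Rightarrow> 'p \<Rightarrow> real) \<Rightarrow> ('l \<Rightarrow> 'p) \<Rightarrow> ('l \<Rightarrow> 'p) \<Rightarrow> 'l \<Rightarrow> real" where
  "link_length \<delta> s r i = \<delta> (s i) (r i)"

text \<open>\<open>affectance \<delta> s r \<alpha> P j i\<close> is the affectance of link \<open>j\<close> on link \<open>i\<close>,
  for noise 0 and threshold 1.\<close>

definition affectance ::
  "('p \<Rightarrow> 'p \<Rightarrow> real) \<Rightarrow> ('l \<Rightarrow> 'p) \<Rightarrow> ('l \<Rightarrow> 'p) \<Rightarrow> real \<Rightarrow> ('l \<Rightarrow> real) \<Rightarrow> 'l \<Rightarrow> 'l \<Rightarrow> real" where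
  "affectance \<delta> s r \<alpha> P j i =
     P j / P i * (link_length \<delta> s r i / link_dist \<delta> s r j i) powr \<alpha>"

definition power_assignment :: "'l set \<Rightarrow> ('l \<Rightarrow> real) \<Rightarrow> bool" where
  "power_assignment L P \<longleftrightarrow> (\<forall>i\<in>L. 0 < P i)"

definition uniform_power :: "'l set \<Rightarrow> ('l \<Rightarrow> real) \<Rightarrow> bool" where
  "uniform_power L P \<longleftrightarrow> power_assignment L P \<and> (\<exists>p. \<forall>i\<in>L. P i = p)"

definition SINR_feasible ::
  "('p \<Rightarrow> 'p \<Rightarrow> real) \<Rightarrow> ('l \<Rightarrow> 'p) \<Rightarrow> ('l \<Rightarrow> 'p) \<Rightarrow> real \<Rightarrow> ('l \<Rightarrow> real) \<Rightarrow> 'l set \<Rightarrow> bool" where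
  "SINR_feasible \<delta> s r \<alpha> P S \<longleftrightarrow> (\<forall>i\<in>S. (\<Sum>j\<in>S - {i}. affectance \<delta> s r \<alpha> P j i) \<le> 1)"

definition all_links :: "nat \<Rightarrow> 'l \<Rightarrow> (nat \<Rightarrow> 'l set) \<Rightarrow> 'l set" where
  "all_links K l1 S = insert l1 (\<Union>k\<in>{1..K}. S k)"

text \<open>Only \<open>S 1, \<dots>, S K\<close> matter. The cardinality condition makes these sets finite,
  since their prescribed cardinalities are nonzero.\<close>

definition star_instance ::
  "real \<Rightarrow> real \<Rightarrow> nat \<Rightarrow> 'p set \<Rightarrow> ('p \<Rightarrow> 'p \<Rightarrow> real) \<Rightarrow> ('l \<Rightarrow> 'p) \<Rightarrow> ('l \<Rightarrow> 'p) \<Rightarrow>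
   'l \<Rightarrow> (nat \<Rightarrow> 'l set) \<Rightarrow> bool" where
  "star_instance \<alpha> \<gamma> K M \<delta> s r l1 S \<longleftrightarrow>
     Metric_space M \<delta> \<and>
     (\<forall>i\<in>all_links K l1 S. s i \<in> M \<and> r i \<in> M) \<and>
     disjoint_family_on S {1..K} \<and>
     (\<forall>k\<in>{1..K}. l1 \<notin> S k \<and> card (S k) = 2 ^ (2 * (k - 1))) \<and>
     (\<forall>i\<in>all_links K l1 S. link_length \<delta> s r i = 1) \<and>
     (\<forall>k\<in>{1..K}. \<forall>i\<in>S k.
        link_dist \<delta> s r i l1 = (\<gamma> * real (card (S k))) powr (1 / \<alpha>) \<and>
        link_dist \<delta> s r l1 i = (\<gamma> * real (card (S k))) powr (1 / \<alpha>)) \<and>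
     (\<forall>i\<in>all_links K l1 S - {l1}. \<forall>j\<in>all_links K l1 S - {l1}. i \<noteq> j \<longrightarrow>
        link_dist \<delta> s r i j = link_dist \<delta> s r i l1 + link_dist \<delta> s r j l1 \<and>
        link_dist \<delta> s r j i = link_dist \<delta> s r i l1 + link_dist \<delta> s r j l1)"

lemma card_all_links:
  assumes "star_instance \<alpha> \<gamma> K M \<delta> s r l1 S"
  shows "finite (all_links K l1 S)"
    and "card (all_links K l1 S) = 1 + (\<Sum>k=1..K. card (S k))"
proof -
  have fin: "finite (S k)" if "k \<in> {1..K}" for k
    using assms that unfolding star_instance_def
    by (metis card.infinite power_not_zero zero_neq_numeral)
  then show "finite (all_links K l1 S)"
    by (simp add: all_links_def)
  have "l1 \<notin> (\<Union>k\<in>{1..K}. S k)"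
    using assms by (auto simp: star_instance_def)
  moreover have "card (\<Union>k\<in>{1..K}. S k) = (\<Sum>k=1..K. card (S k))"
    using assms fin
    by (intro card_UN_disjoint) (auto simp: star_instance_def disjoint_family_on_def)
  ultimately show "card (all_links K l1 S) = 1 + (\<Sum>k=1..K. card (S k))"
    using fin by (simp add: all_links_def)
qed

text \<open>
  The prescribed distances are realised in a metric space: a star with centre \<open>l1\<close> in which
  each endpoint of a spoke (and the centre) is replaced by two points at distance 1.
\<close>

lemma star_instance_exists:
  fixes \<alpha> \<gamma> :: real
  assumes "0 < \<alpha>" "1 \<le> \<gamma>"
  shows "\<exists>(M :: ((nat \<times> nat) \<times> bool) set) \<delta> s r (l1 :: nat \<times> nat) S.
           star_instance \<alpha> \<gamma> K M \<delta> s r l1 S"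
proof -
  define D :: "nat \<times> nat \<Rightarrow> real" where
    "D l = (if l = (0,0) then 0 else (\<gamma> * real (2 ^ (2 * (fst l - 1)))) powr (1 / \<alpha>))" for l
  define \<delta> :: "(nat \<times> nat) \<times> bool \<Rightarrow> (nat \<times> nat) \<times> bool \<Rightarrow> real" where
    "\<delta> x y = (if x = y then 0 else if fst x = fst y then 1 else D (fst x) + D (fst y))" for x y
  define S :: "nat \<Rightarrow> (nat \<times> nat) set" where "S k = {k} \<times> {..<2 ^ (2 * (k - 1))}" for k
  have cS: "card (S k) = 2 ^ (2 * (k - 1))" for k
    by (simp add: S_def card_cartesian_product_singleton)
  have D1: "1 \<le> D l" if "l \<noteq> (0,0)" for l
  proof -
    have "1 * 1 \<le> \<gamma> * real (2 ^ (2 * (fst l - 1)))"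
      using assms by (intro mult_mono) auto
    then show ?thesis using that assms by (auto simp: D_def intro!: ge_one_powr_ge_zero)
  qed
  have D0: "0 \<le> D l" for l by (simp add: D_def)
  have Dsum: "1 \<le> D l + D m" if "l \<noteq> m" for l m
    using D1[of l] D1[of m] D0[of l] D0[of m] that by (cases "l = (0,0)") auto
  have "Metric_space UNIV \<delta>"
  proof
    show "0 \<le> \<delta> x y" for x y using D0 by (simp add: \<delta>_def)
    show "\<delta> x y = \<delta> y x" for x y by (simp add: \<delta>_def)
    show "\<delta> x y = 0 \<longleftrightarrow> x = y" for x y using Dsum[of "fst x" "fst y"] by (auto simp: \<delta>_def)
    show "\<delta> x z \<le> \<delta> x y + \<delta> y z" for x y z
      using Dsum[of "fst x" "fst y"] D0[of "fst x"] D0[of "fst y"] D0[of "fst z"]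
      by (cases x; cases y; cases z) (auto simp: \<delta>_def)
  qed
  then have "star_instance \<alpha> \<gamma> K UNIV \<delta> (\<lambda>l. (l, False)) (\<lambda>l. (l, True)) (0,0) S"
    unfolding star_instance_def cS
    by (auto simp: \<delta>_def link_dist_def link_length_def all_links_def disjoint_family_on_def
        S_def D_def card_cartesian_product_singleton)
  then show ?thesis by blast
qed

end

theory Submission
  imports Defs
begin

text \<open>
  Write \<open>D\<^sub>j\<close> for the distance of link \<open>j\<close> to the centre, so that \<open>D\<^sub>j powr \<alpha> = \<gamma> |S\<^sub>k|\<close> for
  \<open>j \<in> S\<^sub>k\<close>.

  With power \<open>1\<close> for the centre and \<open>|S\<^sub>k| powr (-1/2) = 2 ^ -(k-1)\<close> on \<open>S\<^sub>k\<close>, the total affectance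
  of \<open>S\<^sub>m\<close> on a link of \<open>S\<^sub>k\<close> is at most \<open>2 ^ -|k - m| / \<gamma>\<close>. These bounds sum to at most \<open>3 / \<gamma>\<close>,
  and the centre contributes at most \<open>1 / \<gamma>\<close>.

  Under uniform power, let \<open>T\<close> be feasible and let \<open>i \<in> T\<close> be a non-central link closest to the
  centre. Every other non-central \<open>j \<in> T\<close> has \<open>d\<^sub>j\<^sub>i = D\<^sub>j + D\<^sub>i \<le> 2 D\<^sub>j\<close>, so feasibility at \<open>i\<close> bounds the sum of
  \<open>1 / D\<^sub>j powr \<alpha>\<close> over \<open>T\<close> by a constant. Over all links that sum is \<open>K / \<gamma>\<close>, because each
  \<open>S\<^sub>k\<close> contributes \<open>1 / \<gamma>\<close>; hence the number of parts is of order at least \<open>K\<close>, and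
  \<open>n \<le> 4 ^ K\<close>.
\<close>

text \<open>The terms are \<open>2 ^ -|j - k|\<close>: a geometric series on each side of the peak
  \<open>j = k\<close>, so the total stays below 1 + 1 + 1.\<close>

lemma sum_two_sided_geometric_le:
  fixes k n :: nat
  shows "(\<Sum>j<n. min (2 ^ j / 2 ^ k) (2 ^ k / 2 ^ j) :: real) \<le> 3"
proof -
  \<comment> \<open>The bound 3 alone is not inductive, so it is sharpened to track the rising and
    the falling series. The two branches agree at \<open>n = Suc k\<close>, where both equal
    2.\<close>
  have "(\<Sum>j<n. min (2 ^ j / 2 ^ k) (2 ^ k / 2 ^ j) :: real)
      \<le> (if n \<le> Suc k then 2 ^ n / 2 ^ k else 3 - 2 * 2 ^ k / 2 ^ n)"
  proof (induction n)
    case 0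
    show ?case by simp
  next
    case (Suc n)
    consider "n \<le> k" | "n = Suc k" | "Suc k < n" by linarith
    then show ?case
    proof cases
      case 1
      have "min (2 ^ n / 2 ^ k) (2 ^ k / 2 ^ n) \<le> (2 ^ n / 2 ^ k :: real)" by simp
      then show ?thesis using Suc 1 by simp
    next
      case 2
      then show ?thesis using Suc by simp
    next
      case 3
      have "min (2 ^ n / 2 ^ k) (2 ^ k / 2 ^ n) \<le> (2 ^ k / 2 ^ n :: real)" by simp
      then show ?thesis using Suc 3 by simp
    qed
  qed
  also have "\<dots> \<le> 3"
  proof (cases "n \<le> Suc k")
    case True
    then have "(2::real) ^ n \<le> 2 ^ Suc k" by (intro power_increasing) auto
    also have "\<dots> \<le> 3 * 2 ^ k" by simp
    finally show ?thesis using True by (simp add: field_simps)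
  qed simp
  finally show ?thesis .
qed

section \<open>Distances and affectances in the star instance\<close>

locale star =
  fixes \<alpha> \<gamma> :: real and K :: nat and M :: "'p set" and \<delta> :: "'p \<Rightarrow> 'p \<Rightarrow> real"
    and s r :: "'l \<Rightarrow> 'p" and l1 :: 'l and S :: "nat \<Rightarrow> 'l set"
  assumes star: "star_instance \<alpha> \<gamma> K M \<delta> s r l1 S"
    and \<alpha>_pos: "0 < \<alpha>" and \<gamma>_pos: "0 < \<gamma>"
begin

abbreviation L :: "'l set" where "L \<equiv> all_links K l1 S"
abbreviation d :: "'l \<Rightarrow> 'l \<Rightarrow> real" where "d \<equiv> link_dist \<delta> s r"
abbreviation a :: "('l \<Rightarrow> real) \<Rightarrow> 'l \<Rightarrow> 'l \<Rightarrow> real" where "a \<equiv> affectance \<delta> s r \<alpha>"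

lemma card_S: "k \<in> {1..K} \<Longrightarrow> card (S k) = 2 ^ (2 * (k - 1))"
  using star by (simp add: star_instance_def)

lemma finite_S: "k \<in> {1..K} \<Longrightarrow> finite (S k)"
  using card_S[of k] by (intro card_ge_0_finite) simp

lemma finite_L: "finite L"
  using card_all_links(1)[OF star] .

lemma L_minus_center: "L - {l1} = (\<Union>k\<in>{1..K}. S k)"
  using star by (auto simp: star_instance_def all_links_def)

lemma center_in_L: "l1 \<in> L"
  by (simp add: all_links_def)

lemma length_eq_1: "i \<in> L \<Longrightarrow> link_length \<delta> s r i = 1"
  using star by (simp add: star_instance_def)

lemma S_subset_L: "k \<in> {1..K} \<Longrightarrow> i \<in> S k \<Longrightarrow> i \<in> L - {l1}"
  using L_minus_center by blast

lemma sum_noncenter: "(\<Sum>j\<in>L - {l1}. f j) = (\<Sum>k=1..K. \<Sum>j\<in>S k. f j)"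
  unfolding L_minus_center using star finite_S
  by (intro sum.UNION_disjoint) (auto simp: star_instance_def disjoint_family_on_def)

lemma d_center:
  assumes "k \<in> {1..K}" "i \<in> S k"
  shows "d i l1 = (\<gamma> * 2 ^ (2 * (k - 1))) powr (1 / \<alpha>)" "d l1 i = d i l1"
  using assms star by (auto simp: star_instance_def)

lemma d_center_powr:
  assumes "k \<in> {1..K}" "i \<in> S k"
  shows "d i l1 powr \<alpha> = \<gamma> * 2 ^ (2 * (k - 1))"
  using d_center(1)[OF assms] \<alpha>_pos \<gamma>_pos by (simp add: powr_powr)

lemma d_center_pos:
  assumes "i \<in> L - {l1}"
  shows "0 < d i l1"
proof -
  obtain k where "k \<in> {1..K}" "i \<in> S k" using assms unfolding L_minus_center by blast
  from d_center(1)[OF this] \<gamma>_pos show ?thesis by simp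
qed

lemma d_noncenter:
  assumes "i \<in> L - {l1}" "j \<in> L - {l1}" "i \<noteq> j"
  shows "d i j = d i l1 + d j l1"
  using assms star unfolding star_instance_def by blast

lemma d_pos:
  assumes "i \<in> L" "j \<in> L" "i \<noteq> j"
  shows "0 < d i j"
proof (cases "i = l1 \<or> j = l1")
  case True
  then consider "i = l1" "j \<in> L - {l1}" | "j = l1" "i \<in> L - {l1}" using assms by blast
  then show ?thesis
  proof cases
    case 1
    then obtain k where "k \<in> {1..K}" "j \<in> S k" using L_minus_center by blast
    then show ?thesis using d_center(2) d_center_pos 1 by simp
  qed (simp add: d_center_pos)
next
  case False
  then show ?thesis
    using assms d_noncenter[of i j] d_center_pos[of i] d_center_pos[of j] by simp
qed

lemma affectance_eq:
  assumes "i \<in> L" "j \<in> L" "i \<noteq> j"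
  shows "a P j i = P j / P i / d j i powr \<alpha>"
  using length_eq_1[OF assms(1)] d_pos[of j i] assms
  by (simp add: affectance_def powr_divide)

section \<open>Feasibility with power control\<close>

text \<open>Expressed through the distance to the centre because a link does not carry the index of
  its set; on \<open>S k\<close> the radicand is \<open>1 / card (S k)\<close>.\<close>

definition sqrt_power :: "'l \<Rightarrow> real" where
  "sqrt_power j = (if j = l1 then 1 else sqrt (\<gamma> / d j l1 powr \<alpha>))"

lemma sqrt_power_center: "sqrt_power l1 = 1"
  by (simp add: sqrt_power_def)

lemma sqrt_power_S:
  assumes "k \<in> {1..K}" "i \<in> S k"
  shows "sqrt_power i = 1 / 2 ^ (k - 1)"
proof -
  have "sqrt_power i = sqrt (1 / (2 ^ (k - 1))\<^sup>2)"
    using S_subset_L[OF assms] d_center_powr[OF assms] \<gamma>_pos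
    by (simp add: sqrt_power_def power_even_eq power_divide)
  then show ?thesis by (simp add: real_sqrt_divide)
qed

lemma power_assignment_sqrt_power: "power_assignment L sqrt_power"
  unfolding power_assignment_def
  using d_center_pos \<gamma>_pos by (fastforce simp: sqrt_power_def)

text \<open>The path from \<open>j\<close> to \<open>i\<close> is at least as long as either spoke.
  The spoke of \<open>i\<close> yields one argument of \<open>min\<close>, that of \<open>j\<close>
  the other. The factor \<open>1 / card (S m)\<close> is split off so that it cancels on summing
  over \<open>S m\<close>.\<close>

lemma sqrt_power_affectance_le:
  assumes k: "k \<in> {1..K}" "i \<in> S k" and m: "m \<in> {1..K}" "j \<in> S m" and "i \<noteq> j"
  shows "a sqrt_power j i \<le> min (2 ^ m / 2 ^ k) (2 ^ k / 2 ^ m) / \<gamma> / real (card (S m))"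
proof -
  define x y :: real where "x = 2 ^ (k - 1)" and "y = 2 ^ (m - 1)"
  have xy: "0 < x" "0 < y" by (simp_all add: x_def y_def)
  have iL: "i \<in> L - {l1}" and jL: "j \<in> L - {l1}" using S_subset_L k m by auto
  have *: "d j i = d j l1 + d i l1"
    using d_noncenter[OF jL iL] \<open>i \<noteq> j\<close> by simp
  have "d i l1 powr \<alpha> = \<gamma> * x\<^sup>2" "d j l1 powr \<alpha> = \<gamma> * y\<^sup>2"
    using d_center_powr[OF k] d_center_powr[OF m]
    by (simp_all add: x_def y_def power_even_eq)
  moreover have "d i l1 powr \<alpha> \<le> d j i powr \<alpha>" "d j l1 powr \<alpha> \<le> d j i powr \<alpha>"
    using d_center_pos[OF iL] d_center_pos[OF jL] \<alpha>_pos * by (auto intro!: powr_mono2)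
  ultimately have ge: "\<gamma> * x\<^sup>2 \<le> d j i powr \<alpha>" "\<gamma> * y\<^sup>2 \<le> d j i powr \<alpha>" by simp_all
  have pos: "0 < d j i powr \<alpha> * (\<gamma> * x\<^sup>2)" "0 < d j i powr \<alpha> * (\<gamma> * y\<^sup>2)"
    using xy \<gamma>_pos d_pos[of j i] iL jL \<open>i \<noteq> j\<close> by simp_all
  have eq: "a sqrt_power j i = x / y / d j i powr \<alpha>"
    using affectance_eq[of i j] iL jL \<open>i \<noteq> j\<close> sqrt_power_S[OF k] sqrt_power_S[OF m]
    by (simp add: x_def y_def)
  have "a sqrt_power j i \<le> x / y / (\<gamma> * x\<^sup>2)"
    unfolding eq using ge xy pos by (intro divide_left_mono) auto
  moreover have "x / y / (\<gamma> * x\<^sup>2) = y / x / \<gamma> / y\<^sup>2"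
    using xy \<gamma>_pos by (simp add: field_simps power2_eq_square)
  moreover have "a sqrt_power j i \<le> x / y / (\<gamma> * y\<^sup>2)"
    unfolding eq using ge xy pos by (intro divide_left_mono) auto
  moreover have "x / y / (\<gamma> * y\<^sup>2) = x / y / \<gamma> / y\<^sup>2"
    by simp
  moreover have "real (card (S m)) = y\<^sup>2"
    using card_S[OF m(1)] by (simp add: y_def power_even_eq)
  \<comment> \<open>Since \<open>k\<close> and \<open>m\<close> are at least 1, shifting both
    exponents by one leaves the ratio unchanged.\<close>
  moreover have "(2::real) ^ k = 2 * x" "(2::real) ^ m = 2 * y"
    using k(1) m(1) by (simp_all add: x_def y_def power_eq_if)
  ultimately show ?thesis
    by (simp add: min_def)
qed

text \<open>The threshold 4 is 3 + 1: a link off the centre receives at most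
  \<open>3 / \<gamma>\<close> from the other such links and \<open>1 / \<gamma>\<close> from the
  centre.\<close>

lemma sqrt_power_feasible:
  assumes "4 \<le> \<gamma>"
  shows "SINR_feasible \<delta> s r \<alpha> sqrt_power L"
  unfolding SINR_feasible_def
proof
  fix i assume "i \<in> L"
  show "(\<Sum>j\<in>L - {i}. a sqrt_power j i) \<le> 1"
  proof (cases "i = l1")
    case True
    have "(\<Sum>j\<in>L - {l1}. a sqrt_power j l1) = (\<Sum>k=1..K. \<Sum>j\<in>S k. a sqrt_power j l1)"
      by (rule sum_noncenter)
    \<comment> \<open>As a receiver the centre behaves like a link with index 1, so the same
      two-sided sum applies.\<close>
    also have "\<dots> = (\<Sum>k=1..K. min (2 ^ k / 2 ^ 1) (2 ^ 1 / 2 ^ k) / \<gamma>)"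
    proof (rule sum.cong[OF refl])
      fix k assume k: "k \<in> {1..K}"
      have "a sqrt_power j l1 = 1 / 2 ^ (k - 1) / (\<gamma> * 2 ^ (2 * (k - 1)))" if "j \<in> S k" for j
        using affectance_eq[of l1 j sqrt_power] S_subset_L[OF k that] center_in_L
          sqrt_power_S[OF k that] d_center_powr[OF k that] sqrt_power_center by auto
      then have "(\<Sum>j\<in>S k. a sqrt_power j l1) = 1 / 2 ^ (k - 1) / \<gamma>"
        using card_S[OF k] \<gamma>_pos by simp
      also have "1 / 2 ^ (k - 1) = min (2 ^ k / 2 ^ 1) (2 ^ 1 / 2 ^ k :: real)"
      proof -
        have "(2::real) ^ k = 2 * 2 ^ (k - 1)" using k by (simp add: power_eq_if)
        moreover have "1 / 2 ^ (k - 1) \<le> (1::real)" "(1::real) \<le> 2 ^ (k - 1)" by simp_all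
        then have "1 / 2 ^ (k - 1) \<le> (2 ^ (k - 1) :: real)" by linarith
        ultimately show ?thesis by (simp add: min_def)
      qed
      finally show "(\<Sum>j\<in>S k. a sqrt_power j l1) = min (2 ^ k / 2 ^ 1) (2 ^ 1 / 2 ^ k) / \<gamma>" .
    qed
    also have "\<dots> \<le> (\<Sum>k<Suc K. min (2 ^ k / 2 ^ 1) (2 ^ 1 / 2 ^ k) / \<gamma>)"
      using \<gamma>_pos by (intro sum_mono2) auto
    also have "\<dots> \<le> 3 / \<gamma>"
      unfolding sum_divide_distrib[symmetric]
      using \<gamma>_pos by (intro divide_right_mono sum_two_sided_geometric_le) simp
    also have "\<dots> \<le> 1" using assms by simp
    finally show ?thesis using True by simp
  next
    case False
    then obtain k where k: "k \<in> {1..K}" "i \<in> S k"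
      using \<open>i \<in> L\<close> L_minus_center by blast
    have "(\<Sum>j\<in>L - {i}. a sqrt_power j i) = a sqrt_power l1 i
        + (\<Sum>j\<in>L - {i} - {l1}. a sqrt_power j i)"
      using finite_L center_in_L False by (intro sum.remove) auto
    \<comment> \<open>Replacing the term of \<open>i\<close> by 0 restores the full index set, which
      splits into the sets \<open>S m\<close>.\<close>
    also have "(\<Sum>j\<in>L - {i} - {l1}. a sqrt_power j i)
        = (\<Sum>j\<in>L - {l1}. if j = i then 0 else a sqrt_power j i)"
      using finite_L by (intro sum.mono_neutral_cong_left) auto
    also have "\<dots> = (\<Sum>m=1..K. \<Sum>j\<in>S m. if j = i then 0 else a sqrt_power j i)"
      by (rule sum_noncenter)
    also have "\<dots> \<le> (\<Sum>m=1..K. min (2 ^ m / 2 ^ k) (2 ^ k / 2 ^ m) / \<gamma>)"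
    proof (rule sum_mono)
      fix m assume m: "m \<in> {1..K}"
      have "(\<Sum>j\<in>S m. if j = i then 0 else a sqrt_power j i)
          \<le> (\<Sum>j\<in>S m. min (2 ^ m / 2 ^ k) (2 ^ k / 2 ^ m) / \<gamma> / real (card (S m)))"
        using sqrt_power_affectance_le[OF k m] \<gamma>_pos by (intro sum_mono) auto
      then show "(\<Sum>j\<in>S m. if j = i then 0 else a sqrt_power j i)
          \<le> min (2 ^ m / 2 ^ k) (2 ^ k / 2 ^ m) / \<gamma>"
        using card_S[OF m] by simp
    qed
    also have "\<dots> \<le> (\<Sum>m<Suc K. min (2 ^ m / 2 ^ k) (2 ^ k / 2 ^ m) / \<gamma>)"
      using \<gamma>_pos by (intro sum_mono2) auto
    also have "\<dots> \<le> 3 / \<gamma>"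
      unfolding sum_divide_distrib[symmetric]
      using \<gamma>_pos by (intro divide_right_mono sum_two_sided_geometric_le) simp
    also have "a sqrt_power l1 i = 1 / \<gamma> / 2 ^ (k - 1)"
      using affectance_eq[of i l1] \<open>i \<in> L\<close> center_in_L False sqrt_power_S[OF k]
        d_center(2)[OF k] d_center_powr[OF k]
      by (simp add: sqrt_power_def power_even_eq power2_eq_square)
    also have "\<dots> \<le> 1 / \<gamma> / 1"
      using \<gamma>_pos by (intro divide_left_mono) auto
    also have "1 / \<gamma> / 1 + 3 / \<gamma> \<le> 1" using assms by (simp add: field_simps)
    finally show ?thesis by simp
  qed
qed

section \<open>Lower bound for uniform power\<close>

lemma uniform_feasible_sum_le:
  assumes U: "uniform_power L U" and T: "T \<subseteq> L" and feas: "SINR_feasible \<delta> s r \<alpha> U T"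
  shows "(\<Sum>j\<in>T - {l1}. 1 / d j l1 powr \<alpha>) \<le> 2 powr \<alpha> + 1 / \<gamma>"
proof (cases "T - {l1} = {}")
  case True
  then show ?thesis unfolding True using \<gamma>_pos by simp
next
  case False
  have fin: "finite T" using finite_L T finite_subset by blast
  obtain i where i: "i \<in> T - {l1}" and min: "\<And>j. j \<in> T - {l1} \<Longrightarrow> d i l1 \<le> d j l1"
    using ex_is_arg_min_if_finite[of "T - {l1}" "\<lambda>j. d j l1"] False fin
    by (auto simp: is_arg_min_linorder)
  have iL: "i \<in> L - {l1}" using i T by blast
  have a_eq: "a U j i = 1 / d j i powr \<alpha>" if "j \<in> T - {i}" for j
  proof -
    have "U j / U i = 1"
    proof -
      have "i \<in> L" "j \<in> L" using that i T by auto
      then have "U j = U i" "0 < U i"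
        using U unfolding uniform_power_def power_assignment_def by metis+
      then show ?thesis by simp
    qed
    moreover have "a U j i = U j / U i / d j i powr \<alpha>"
      using that i T by (intro affectance_eq) auto
    ultimately show ?thesis by simp
  qed
  have "(\<Sum>j\<in>T - {l1} - {i}. 1 / d j l1 powr \<alpha>) \<le> (\<Sum>j\<in>T - {l1} - {i}. 2 powr \<alpha> * a U j i)"
  proof (rule sum_mono)
    fix j assume j: "j \<in> T - {l1} - {i}"
    then have jL: "j \<in> L - {l1}" and jT: "j \<in> T - {i}" using T by auto
    have "d j i \<le> 2 * d j l1" "0 < d j i"
      using d_noncenter[OF jL iL] j min[of j] d_center_pos[OF iL] d_center_pos[OF jL] by auto
    then have "d j i powr \<alpha> \<le> 2 powr \<alpha> * d j l1 powr \<alpha>" "0 < d j i powr \<alpha>"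
      using powr_mono2[of \<alpha> "d j i" "2 * d j l1"] \<alpha>_pos d_center_pos[OF jL]
      by (auto simp: powr_mult)
    then show "1 / d j l1 powr \<alpha> \<le> 2 powr \<alpha> * a U j i"
      unfolding a_eq[OF jT] using d_center_pos[OF jL] by (simp add: field_simps)
  qed
  also have "\<dots> = 2 powr \<alpha> * (\<Sum>j\<in>T - {l1} - {i}. a U j i)"
    by (simp add: sum_distrib_left)
  \<comment> \<open>Feasibility also counts the centre if it lies in \<open>T\<close>; its
    affectance is nonnegative.\<close>
  also have "(\<Sum>j\<in>T - {l1} - {i}. a U j i) \<le> (\<Sum>j\<in>T - {i}. a U j i)"
    using fin a_eq by (intro sum_mono2) auto
  also have "\<dots> \<le> 1" using feas i by (simp add: SINR_feasible_def)
  finally have "(\<Sum>j\<in>T - {l1} - {i}. 1 / d j l1 powr \<alpha>) \<le> 2 powr \<alpha>" by simp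
  \<comment> \<open>Feasibility at \<open>i\<close> says nothing about the weight of
    \<open>i\<close> itself, which is largest when \<open>i\<close> lies in
    \<open>S 1\<close>.\<close>
  moreover have "1 / d i l1 powr \<alpha> \<le> 1 / \<gamma>"
  proof -
    obtain k where k: "k \<in> {1..K}" "i \<in> S k" using iL L_minus_center by blast
    have "\<gamma> * 1 \<le> d i l1 powr \<alpha>"
      unfolding d_center_powr[OF k] using \<gamma>_pos by (intro mult_left_mono) auto
    then show ?thesis using frac_le[of 1 1 \<gamma>] \<gamma>_pos by simp
  qed
  ultimately show ?thesis
    using sum.remove[of "T - {l1}" i "\<lambda>j. 1 / d j l1 powr \<alpha>"] fin i by simp
qed

lemma sum_noncenter_weights: "(\<Sum>j\<in>L - {l1}. 1 / d j l1 powr \<alpha>) = real K / \<gamma>"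
proof -
  have "(\<Sum>j\<in>S k. 1 / d j l1 powr \<alpha>) = 1 / \<gamma>" if "k \<in> {1..K}" for k
    using d_center_powr[OF that] card_S[OF that] by simp
  then show ?thesis unfolding sum_noncenter by simp
qed

lemma K_le_card_uniform_partition:
  assumes U: "uniform_power L U" and part: "partition_on L \<P>"
    and feas: "\<forall>T\<in>\<P>. SINR_feasible \<delta> s r \<alpha> U T"
  shows "real K \<le> (\<gamma> * 2 powr \<alpha> + 1) * real (card \<P>)"
proof -
  have fin: "finite \<P>" using part finite_L by (rule finite_elements[rotated])
  have sub: "T \<subseteq> L" if "T \<in> \<P>" for T using part that by (auto simp: partition_on_def)
  have "L - {l1} = (\<Union>T\<in>\<P>. T - {l1})" using part by (auto simp: partition_on_def)
  then have "real K / \<gamma> = (\<Sum>j\<in>(\<Union>T\<in>\<P>. T - {l1}). 1 / d j l1 powr \<alpha>)"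
    using sum_noncenter_weights by simp
  \<comment> \<open>The sum is indexed by the parts themselves, so a part that becomes empty without
    the centre does no harm.\<close>
  also have "\<dots> = (\<Sum>T\<in>\<P>. \<Sum>j\<in>T - {l1}. 1 / d j l1 powr \<alpha>)"
  proof (intro sum.UNION_disjoint ballI impI)
    show "finite (T - {l1})" if "T \<in> \<P>" for T
      using finite_subset[OF sub[OF that] finite_L] by simp
    show "(T - {l1}) \<inter> (T' - {l1}) = {}" if "T \<in> \<P>" "T' \<in> \<P>" "T \<noteq> T'" for T T'
      using part that by (blast dest: partition_onD2 disjointD)
  qed (rule fin)
  also have "\<dots> \<le> (\<Sum>T\<in>\<P>. 2 powr \<alpha> + 1 / \<gamma>)"
    using uniform_feasible_sum_le[OF U] sub feas by (intro sum_mono) auto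
  finally show ?thesis using \<gamma>_pos by (simp add: field_simps)
qed

text \<open>A crude bound suffices: each new set has \<open>4 ^ K\<close> links, and
  \<open>4 ^ K + 4 ^ K \<le> 4 ^ Suc K\<close>.\<close>

lemma card_L_le: "card L \<le> 4 ^ K"
proof -
  have "card L = 1 + (\<Sum>k=1..K. 2 ^ (2 * (k - 1)))"
    using card_all_links(2)[OF star] card_S by simp
  also have "\<dots> \<le> 4 ^ K"
    by (induction K) (auto simp: power_mult)
  finally show ?thesis .
qed

lemma ln_card_L_le: "ln (real (card L)) \<le> real K * ln 4"
proof -
  have "0 < card L" using finite_L center_in_L card_gt_0_iff by blast
  moreover have "real (card L) \<le> 4 ^ K"
    using card_L_le by (metis of_nat_le_iff of_nat_numeral of_nat_power)
  ultimately have "ln (real (card L)) \<le> ln (4 ^ K)" by (intro ln_mono) auto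
  then show ?thesis by (simp add: ln_realpow)
qed

end

theorem theorem8:
  fixes \<alpha> :: real
  assumes "0 < \<alpha>"
  shows
    "(\<forall>K\<ge>1. \<forall>(M :: 'p set) \<delta> s r (l1 :: 'l) S.
        star_instance \<alpha> 14 K M \<delta> s r l1 S \<longrightarrow>
        (\<exists>P. power_assignment (all_links K l1 S) P \<and>
             SINR_feasible \<delta> s r \<alpha> P (all_links K l1 S))) \<and>
     (\<exists>c>0. \<exists>K0\<ge>1. \<forall>K\<ge>K0. \<forall>(M :: 'p set) \<delta> s r (l1 :: 'l) S.
        star_instance \<alpha> 14 K M \<delta> s r l1 S \<longrightarrow>
        (\<forall>U \<P>. uniform_power (all_links K l1 S) U \<longrightarrow>
               partition_on (all_links K l1 S) \<P> \<longrightarrow>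
               (\<forall>T\<in>\<P>. SINR_feasible \<delta> s r \<alpha> U T) \<longrightarrow>
               c * ln (real (card (all_links K l1 S))) \<le> real (card \<P>)))"
proof -
  define C :: real where "C = 14 * 2 powr \<alpha> + 1"
  have C: "0 < C" by (simp add: C_def add_pos_pos)
  have star: "star \<alpha> 14 K M \<delta> s r l1 S" if "star_instance \<alpha> 14 K M \<delta> s r l1 S"
    for K and M :: "'p set" and \<delta> s r and l1 :: 'l and S
    using that assms by unfold_locales auto
  have "1 / (C * ln 4) * ln (real (card (all_links K l1 S))) \<le> real (card \<P>)"
    if "star_instance \<alpha> 14 K M \<delta> s r l1 S" "uniform_power (all_links K l1 S) U"
      "partition_on (all_links K l1 S) \<P>" "\<forall>T\<in>\<P>. SINR_feasible \<delta> s r \<alpha> U T"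
    for K and M :: "'p set" and \<delta> s r and l1 :: 'l and S U \<P>
  proof -
    interpret star \<alpha> 14 K M \<delta> s r l1 S using star that(1) .
    have "ln (real (card L)) \<le> real K * ln 4" by (rule ln_card_L_le)
    also have "\<dots> \<le> C * real (card \<P>) * ln 4"
      using K_le_card_uniform_partition[OF that(2-4)] by (intro mult_right_mono) (auto simp: C_def)
    finally show ?thesis using C by (simp add: field_simps)
  qed
  moreover have "0 < 1 / (C * ln 4)" using C by simp
  moreover have "\<exists>P. power_assignment (all_links K l1 S) P \<and>
      SINR_feasible \<delta> s r \<alpha> P (all_links K l1 S)"
    if "star_instance \<alpha> 14 K M \<delta> s r l1 S"
    for K and M :: "'p set" and \<delta> s r and l1 :: 'l and S
  proof -
    interpret star \<alpha> 14 K M \<delta> s r l1 S using star that .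
    show ?thesis using power_assignment_sqrt_power sqrt_power_feasible by fastforce
  qed
  \<comment> \<open>The estimate holds for every \<open>K\<close>, so \<open>K0 = 1\<close> serves,
    with \<open>c = 1 / (C * ln 4)\<close>.\<close>
  ultimately show ?thesis by (blast intro: order_refl)
qed

end
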